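(* Every bounded finite abelian processor can be emulated by a finite, directed acyclic abelian network whose nodes are adders, splitters, delayers and presinks.
   Context: $\mathbb{N}=\{0,1,2,\dots\}$. A processor with finite input alphabet $A$, finite output alphabet $B$ and finite state space $Q$ consists of transition maps $t_i:Q\to Q$ and output maps $o_i:Q\to\mathbb{N}^B$ ($i\in A$): on receiving letter $i$ in state $q$ it moves to $t_i(q)$ and emits $(o_i(q))_b$ copies of letter $b$ for each $b$. It is abelian if $t_it_j=t_jt_i$ and $o_i+o_j\circ t_i=o_j+o_i\circ t_j$ for all $i,j$. Every processor has an initial state $q^0$ from which every state is reachable by compositions of transition maps. It computes $F:\mathbb{N}^A\to\mathbb{N}^B$, where $F(\mathbf{x})$ is the total output when, from $q^0$, it receives $x_a$ letters $a$ for each $a$ (order-independent). The processor is bounded if the range of $F$ is a finite subset of $\mathbb{N}^B$. An abelian network is a finite directed multigraph with pairwise disjoint sets of dangling input edges (no tail), output edges and trash edges (no head); each node carries a finite abelian processor (with an initial state) whose input alphabet is its set of incoming edges and output alphabet its set of outgoing edges. Given letters on input edges, the network repeatedly picks any non-output, non-trash edge carrying a letter and feeds one letter to the processor at its head, which changes state and places emitted letters on its outgoing edges; it halts when all letters lie on output or trash edges. Halting and the output are independent of the choices; a network halting on all inputs computes a function, and emulates a processor if it computes the same function. It is directed acyclic if its graph has no directed cycle. Gates (each may start in any of its states): an adder (one state, two inputs, one output, computes $(x,y)\mapsto x+y$); a splitter (one state, one input, two outputs, computes $x\mapsto (x,x)$); a delayer with states $0,1$: in state $0$ a received letter moves it to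 state $1$ emitting nothing, in state $1$ it emits one letter per letter received; a presink with states $0,1$: in state $0$ a received letter moves it to state $1$ and it emits one letter, in state $1$ all letters are ignored.
   Formalization: The formal statement assumes that a processor with a nonempty output alphabet has a nonempty input alphabet; with no input letters and some output letter, no acyclic network of these gates has an output edge, so the claim fails there. *)

theory Defs
  imports Main "HOL-Library.Multiset"
begin

section \<open>Processors\<close>

text \<open>
  For a finite alphabet A, a vector in \<open>\<nat>\<^sup>A\<close> is represented by the multiset over A with these
  multiplicities; the alphabets are carrier sets.
\<close>

record ('a, 'b, 'q) processor =
  inputs :: "'a set"
  outputs :: "'b set"
  states :: "'q set"
  init :: 'q
  trans :: "'a \<Rightarrow> 'q \<Rightarrow> 'q"
  emit :: "'a \<Rightarrow> 'q \<Rightarrow> 'b multiset"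

locale processor =
  fixes P :: "('a, 'b, 'q) processor"
  assumes finite_inputs: "finite (inputs P)"
    and finite_outputs: "finite (outputs P)"
    and init_in_states: "init P \<in> states P"
    and trans_in_states: "i \<in> inputs P \<Longrightarrow> q \<in> states P \<Longrightarrow> trans P i q \<in> states P"
    and emit_in_outputs: "i \<in> inputs P \<Longrightarrow> q \<in> states P \<Longrightarrow> set_mset (emit P i q) \<subseteq> outputs P"

locale abelian_processor = processor P for P :: "('a, 'b, 'q) processor" +
  assumes trans_commute:
      "i \<in> inputs P \<Longrightarrow> j \<in> inputs P \<Longrightarrow> q \<in> states P \<Longrightarrow>
         trans P i (trans P j q) = trans P j (trans P i q)"
    and emit_commute:
      "i \<in> inputs P \<Longrightarrow> j \<in> inputs P \<Longrightarrow> q \<in> states P \<Longrightarrow>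
         emit P i q + emit P j (trans P i q) = emit P j q + emit P i (trans P j q)"

locale finite_abelian_processor = abelian_processor P for P :: "('a, 'b, 'q) processor" +
  assumes finite_states: "finite (states P)"

text \<open>
  Reachability is not part of the locales above: the gates below may start in any of their
  states, and a delayer or presink that starts in state 1 never visits state 0.
\<close>

definition all_states_reachable :: "('a, 'b, 'q) processor \<Rightarrow> bool" where
  "all_states_reachable P \<longleftrightarrow>
     (\<forall>q \<in> states P. \<exists>w \<in> lists (inputs P). fold (trans P) w (init P) = q)"

primrec total_output :: "('a, 'b, 'q) processor \<Rightarrow> 'q \<Rightarrow> 'a list \<Rightarrow> 'b multiset" where
  "total_output P q [] = {#}"
| "total_output P q (i # w) = emit P i q + total_output P (trans P i q) w"

text \<open>
  The order in which the letters of x are received is immaterial for an abelian processor, see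
  \<open>total_output_eq_computed_fun\<close> below.
\<close>

definition computed_fun :: "('a, 'b, 'q) processor \<Rightarrow> 'a multiset \<Rightarrow> 'b multiset" where
  "computed_fun P x = total_output P (init P) (SOME w. mset w = x)"

definition bounded_processor :: "('a, 'b, 'q) processor \<Rightarrow> bool" where
  "bounded_processor P \<longleftrightarrow> finite (computed_fun P ` {x. set_mset x \<subseteq> inputs P})"

context abelian_processor
begin

lemma total_output_insert:
  assumes "i \<in> inputs P" "q \<in> states P" "set (u @ v) \<subseteq> inputs P"
  shows "total_output P q (u @ i # v) = total_output P q (i # u @ v)"
  using assms
proof (induction u arbitrary: q)
  case Nil
  then show ?case by simp
next
  case (Cons j u)
  have "total_output P q ((j # u) @ i # v)
      = emit P j q + emit P i (trans P j q) + total_output P (trans P i (trans P j q)) (u @ v)"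
    using Cons by (simp add: trans_in_states add.assoc)
  also have "\<dots> = emit P i q + emit P j (trans P i q) + total_output P (trans P j (trans P i q)) (u @ v)"
    using Cons.prems by (simp add: trans_commute[of i j] emit_commute[of i j])
  finally show ?case by (simp add: add.assoc)
qed

lemma total_output_perm:
  assumes "mset w = mset w'" "q \<in> states P" "set w \<subseteq> inputs P"
  shows "total_output P q w = total_output P q w'"
  using assms
proof (induction w arbitrary: w' q)
  case Nil
  then show ?case by simp
next
  case (Cons i w)
  have "i \<in> set w'"
    by (metis Cons.prems(1) list.set_intros(1) set_mset_mset)
  then obtain u v where w': "w' = u @ i # v"
    by (meson split_list)
  with Cons.prems have eq: "mset w = mset (u @ v)" by simp
  then have sub: "set (u @ v) \<subseteq> inputs P"
    using Cons.prems(3) mset_eq_setD[OF eq] by simp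
  have "total_output P (trans P i q) w = total_output P (trans P i q) (u @ v)"
    using Cons.prems eq by (intro Cons.IH) (auto simp: trans_in_states)
  then show ?case
    using total_output_insert[of i q u v] Cons.prems sub w' by simp
qed

lemma total_output_eq_computed_fun:
  assumes "set w \<subseteq> inputs P"
  shows "total_output P (init P) w = computed_fun P (mset w)"
  unfolding computed_fun_def
  by (rule total_output_perm[OF _ init_in_states assms])
    (metis (mono_tags, lifting) someI)

end

section \<open>Abelian networks\<close>

text \<open>\<open>None\<close> as tail or head of an edge means that the edge is dangling at that end.\<close>

record ('v, 'e, 's) network =
  nodes :: "'v set"
  edges :: "'e set"
  input_edges :: "'e set"
  output_edges :: "'e set"
  trash_edges :: "'e set"
  tail :: "'e \<Rightarrow> 'v option"
  head :: "'e \<Rightarrow> 'v option"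
  proc :: "'v \<Rightarrow> ('e, 'e, 's) processor"

definition incoming :: "('v, 'e, 's) network \<Rightarrow> 'v \<Rightarrow> 'e set" where
  "incoming N v = {e \<in> edges N. head N e = Some v}"

definition outgoing :: "('v, 'e, 's) network \<Rightarrow> 'v \<Rightarrow> 'e set" where
  "outgoing N v = {e \<in> edges N. tail N e = Some v}"

locale abelian_network =
  fixes N :: "('v, 'e, 's) network"
  assumes finite_nodes: "finite (nodes N)"
    and finite_edges: "finite (edges N)"
    and dangling_edges: "input_edges N \<subseteq> edges N" "output_edges N \<subseteq> edges N" "trash_edges N \<subseteq> edges N"
    and disjoint_edges: "input_edges N \<inter> output_edges N = {}" "input_edges N \<inter> trash_edges N = {}"
      "output_edges N \<inter> trash_edges N = {}"
    and tail_None_iff: "e \<in> edges N \<Longrightarrow> tail N e = None \<longleftrightarrow> e \<in> input_edges N"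
    and head_None_iff: "e \<in> edges N \<Longrightarrow> head N e = None \<longleftrightarrow> e \<in> output_edges N \<union> trash_edges N"
    and tail_in_nodes: "e \<in> edges N \<Longrightarrow> tail N e = Some v \<Longrightarrow> v \<in> nodes N"
    and head_in_nodes: "e \<in> edges N \<Longrightarrow> head N e = Some v \<Longrightarrow> v \<in> nodes N"
    and proc_abelian: "v \<in> nodes N \<Longrightarrow> finite_abelian_processor (proc N v)"
    and proc_inputs: "v \<in> nodes N \<Longrightarrow> inputs (proc N v) = incoming N v"
    and proc_outputs: "v \<in> nodes N \<Longrightarrow> outputs (proc N v) = outgoing N v"

definition directed_acyclic :: "('v, 'e, 's) network \<Rightarrow> bool" where
  "directed_acyclic N \<longleftrightarrow> acyclic {(u, v). \<exists>e \<in> edges N. tail N e = Some u \<and> head N e = Some v}"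

text \<open>A configuration: the states of the processors and the multiset of edges carrying letters.\<close>

type_synonym ('v, 'e, 's) config = "('v \<Rightarrow> 's) \<times> 'e multiset"

definition start_config :: "('v, 'e, 's) network \<Rightarrow> 'e multiset \<Rightarrow> ('v, 'e, 's) config" where
  "start_config N x = ((\<lambda>v. init (proc N v)), x)"

inductive step :: "('v, 'e, 's) network \<Rightarrow> ('v, 'e, 's) config \<Rightarrow> ('v, 'e, 's) config \<Rightarrow> bool"
  for N where
  "\<lbrakk>e \<in># L; e \<notin> output_edges N \<union> trash_edges N; head N e = Some v\<rbrakk> \<Longrightarrow>
     step N (\<sigma>, L) (\<sigma>(v := trans (proc N v) e (\<sigma> v)), L - {#e#} + emit (proc N v) e (\<sigma> v))"

definition halted :: "('v, 'e, 's) network \<Rightarrow> ('v, 'e, 's) config \<Rightarrow> bool" where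
  "halted N c \<longleftrightarrow> set_mset (snd c) \<subseteq> output_edges N \<union> trash_edges N"

text \<open>Both conjuncts quantify over all possible choices of the letters to be processed.\<close>

definition halts_with_output :: "('v, 'e, 's) network \<Rightarrow> 'e multiset \<Rightarrow> 'e multiset \<Rightarrow> bool" where
  "halts_with_output N x y \<longleftrightarrow>
     \<not> (\<exists>c :: nat \<Rightarrow> ('v, 'e, 's) config. c 0 = start_config N x \<and> (\<forall>n. step N (c n) (c (Suc n)))) \<and>
     (\<forall>c. (step N)\<^sup>*\<^sup>* (start_config N x) c \<and> halted N c \<longrightarrow>
        filter_mset (\<lambda>e. e \<in> output_edges N) (snd c) = y)"

text \<open>
  The input and output letters of P are identified with the input and output edges of N along
  the bijections \<open>\<alpha>\<close> and \<open>\<beta>\<close>.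
\<close>

definition emulates :: "('v, 'e, 's) network \<Rightarrow> ('a, 'b, 'q) processor \<Rightarrow> bool" where
  "emulates N P \<longleftrightarrow>
     (\<exists>\<alpha> \<beta>. bij_betw \<alpha> (inputs P) (input_edges N) \<and> bij_betw \<beta> (outputs P) (output_edges N) \<and>
        (\<forall>x. set_mset x \<subseteq> inputs P \<longrightarrow>
           halts_with_output N (image_mset \<alpha> x) (image_mset \<beta> (computed_fun P x))))"

section \<open>Gates\<close>

definition is_adder :: "('a, 'b, nat) processor \<Rightarrow> bool" where
  "is_adder P \<longleftrightarrow>
     (\<exists>i j k. i \<noteq> j \<and> inputs P = {i, j} \<and> outputs P = {k} \<and> states P = {0} \<and> init P = 0 \<and>
        trans P i 0 = 0 \<and> emit P i 0 = {#k#} \<and>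
        trans P j 0 = 0 \<and> emit P j 0 = {#k#})"

definition is_splitter :: "('a, 'b, nat) processor \<Rightarrow> bool" where
  "is_splitter P \<longleftrightarrow>
     (\<exists>i k l. k \<noteq> l \<and> inputs P = {i} \<and> outputs P = {k, l} \<and> states P = {0} \<and> init P = 0 \<and>
        trans P i 0 = 0 \<and> emit P i 0 = {#k, l#})"

definition is_delayer :: "('a, 'b, nat) processor \<Rightarrow> bool" where
  "is_delayer P \<longleftrightarrow>
     (\<exists>i k. inputs P = {i} \<and> outputs P = {k} \<and> states P = {0, 1} \<and> init P \<in> {0, 1} \<and>
        trans P i 0 = 1 \<and> emit P i 0 = {#} \<and>
        trans P i 1 = 1 \<and> emit P i 1 = {#k#})"

definition is_presink :: "('a, 'b, nat) processor \<Rightarrow> bool" where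
  "is_presink P \<longleftrightarrow>
     (\<exists>i k. inputs P = {i} \<and> outputs P = {k} \<and> states P = {0, 1} \<and> init P \<in> {0, 1} \<and>
        trans P i 0 = 1 \<and> emit P i 0 = {#k#} \<and>
        trans P i 1 = 1 \<and> emit P i 1 = {#})"

end

(*
  A bounded computed function F is monotone and saturates: for a suitable K, the value F x is
  already attained at some m below x all of whose multiplicities are at most K. Hence each output
  component F_b x is the sum over c of the bits [c < F_b x], and such a bit is a finite disjunction,
  over the bounded m with c < F_b m, of conjunctions of threshold tests m_a <= x_a. Chains of
  delayers followed by a presink test thresholds; an adder followed by a presink is "or", an adder
  followed by a delayer is "and".

  For a network without directed cycles, a consistent assignment of loads to the edges is unique
  and bounds the letters of every execution from above; this gives halting, and the output edges
  of a halted configuration carry exactly their loads.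
*)
theory Submission
  imports Defs
begin

section \<open>Runs of one repeated letter, and why they fall silent\<close>

section \<open>Saturation of bounded processors\<close>

text \<open>Boundedness speaks only of runs from the initial state. Reachability carries it over to
  every state, and finiteness of the states and of the alphabet makes the saturation bound
  \<open>K\<close> uniform.

  Two limits of gates shape the rest. Even the constant 0 needs an edge that feeds a silent presink.
  Moreover an edge enters at most one gate, so a computed function is used up by its first use. A
  network is therefore described by the multiset of functions on its output edges, treated as a
  stock: a gate takes some functions out and puts others in, splitters replenish the input counts,
  and leftovers become trash. Growth happens only at output edges, so the loads of the larger
  network can be written down at once and no execution has to be followed during the
  construction.\<close>

lemma total_output_append:
  "total_output P q (u @ v) = total_output P q u + total_output P (fold (trans P) u q) v"
  by (induction u arbitrary: q) (auto simp: add.assoc)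

context processor
begin

lemma fold_trans_in_states:
  "set w \<subseteq> inputs P \<Longrightarrow> q \<in> states P \<Longrightarrow> fold (trans P) w q \<in> states P"
  by (induction w arbitrary: q) (auto simp: trans_in_states)

lemma total_output_in_outputs:
  "set w \<subseteq> inputs P \<Longrightarrow> q \<in> states P \<Longrightarrow> set_mset (total_output P q w) \<subseteq> outputs P"
proof (induction w arbitrary: q)
  case (Cons i w)
  then show ?case
    using emit_in_outputs[of i q] Cons.IH[of "trans P i q"] by (auto simp: trans_in_states)
qed simp

end

context abelian_processor
begin

lemma computed_fun_in_outputs:
  assumes "set_mset x \<subseteq> inputs P"
  shows "set_mset (computed_fun P x) \<subseteq> outputs P"
proof -
  obtain w where w: "mset w = x" using ex_mset by blast
  then have "set w \<subseteq> inputs P" using assms by auto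
  then show ?thesis
    using total_output_in_outputs[of w "init P"] total_output_eq_computed_fun[of w] w
    by (simp add: init_in_states)
qed

lemma computed_fun_mono:
  assumes "set_mset y \<subseteq> inputs P" "x \<subseteq># y"
  shows "computed_fun P x \<subseteq># computed_fun P y"
proof -
  obtain z where y: "y = x + z" using assms(2) by (auto simp: mset_subset_eq_exists_conv)
  obtain u v where uv: "mset u = x" "mset v = z" using ex_mset by metis
  have "set (u @ v) \<subseteq> inputs P" using assms(1) y uv by auto
  then show ?thesis
    using total_output_eq_computed_fun[of u] total_output_eq_computed_fun[of "u @ v"]
    unfolding y uv[symmetric] mset_append[symmetric]
    by (auto simp: total_output_append simp del: mset_append dest: sym)
qed

lemma computed_fun_empty [simp]: "computed_fun P {#} = {#}"
  using total_output_eq_computed_fun[of "[]"] by simp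

lemma computed_fun_add_replicate:
  assumes "set w \<subseteq> inputs P" "i \<in> inputs P"
  shows "computed_fun P (mset w + replicate_mset n i)
           = computed_fun P (mset w) + total_output P (fold (trans P) w (init P)) (replicate n i)"
proof -
  have "set (w @ replicate n i) \<subseteq> inputs P" using assms by (auto simp: set_replicate_conv_if)
  then show ?thesis
    using total_output_eq_computed_fun[of "w @ replicate n i"] total_output_eq_computed_fun[of w]
    by (simp add: total_output_append)
qed

end

lemma mono_bounded_nat_stabilizes:
  fixes f :: "nat \<Rightarrow> nat"
  assumes "mono f" "\<And>n. f n \<le> C"
  obtains K where "\<And>n. n \<ge> K \<Longrightarrow> f n = f K"
proof -
  obtain K where "\<And>n. f n \<le> f K"
    using ex_has_greatest_nat[of "\<lambda>_. True" 0 f C] assms(2) by (auto simp: le_less)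
  then show ?thesis
    using that[of K] assms(1) by (simp add: antisym monoD)
qed

text \<open>The recursion of \<open>total_output\<close> strips the first letter; splitting off the
  last one instead exhibits the emission after \<open>n\<close> copies of \<open>i\<close> as an
  increment of the total output.\<close>

lemma total_output_replicate_Suc:
  "total_output P q (replicate (Suc n) i)
     = total_output P q (replicate n i) + emit P i (fold (trans P) (replicate n i) q)"
  unfolding replicate_Suc replicate_append_same[symmetric] by (simp add: total_output_append)

locale bounded_finite_abelian_processor = finite_abelian_processor P
  for P :: "('a, 'b, 'q) processor" +
  assumes reachable: "all_states_reachable P"
    and bounded: "bounded_processor P"
begin

lemma size_computed_fun_bounded:
  obtains C where "\<And>x. set_mset x \<subseteq> inputs P \<Longrightarrow> size (computed_fun P x) \<le> C"
proof -
  have "finite (size ` computed_fun P ` {x. set_mset x \<subseteq> inputs P})"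
    using bounded by (simp add: bounded_processor_def)
  then show ?thesis
    using that[of "Max (size ` computed_fun P ` {x. set_mset x \<subseteq> inputs P})"]
    by (auto intro!: Max_ge)
qed

text \<open>Prefixing a word that leads to \<open>q\<close> turns a run from \<open>q\<close> into a
  run from the initial state, whose output has size at most \<open>C\<close>. Hence the sizes of the
  outputs along copies of \<open>i\<close> form a bounded monotone sequence, and its increments, the
  emissions, are eventually empty.\<close>

lemma emit_eventually_empty:
  assumes "q \<in> states P" "i \<in> inputs P"
  shows "\<exists>K. \<forall>n\<ge>K. emit P i (fold (trans P) (replicate n i) q) = {#}"
proof -
  obtain C where C: "\<And>x. set_mset x \<subseteq> inputs P \<Longrightarrow> size (computed_fun P x) \<le> C"
    using size_computed_fun_bounded by blast
  obtain w where w: "set w \<subseteq> inputs P" "fold (trans P) w (init P) = q"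
    using reachable assms(1) by (force simp: all_states_reachable_def)
  let ?f = "\<lambda>n. size (total_output P q (replicate n i))"
  have "mono ?f"
    by (rule mono_iff_le_Suc[THEN iffD2])
      (simp only: total_output_replicate_Suc, simp)
  moreover have "?f n \<le> C" for n
  proof -
    have "set_mset (mset w + replicate_mset n i) \<subseteq> inputs P"
      using w(1) assms(2) by (auto simp: in_replicate_mset)
    then show ?thesis
      using C[of "mset w + replicate_mset n i"] w assms(2) by (simp add: computed_fun_add_replicate)
  qed
  ultimately obtain K where K: "\<And>n. n \<ge> K \<Longrightarrow> ?f n = ?f K"
    using mono_bounded_nat_stabilizes by blast
  have "emit P i (fold (trans P) (replicate n i) q) = {#}" if "n \<ge> K" for n
    using K[OF that] K[of "Suc n"] that by (simp only: total_output_replicate_Suc) simp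
  then show ?thesis by blast
qed

lemma uniform_saturation:
  obtains K where "\<And>x i. set_mset x \<subseteq> inputs P \<Longrightarrow> count x i > K \<Longrightarrow>
      computed_fun P (x - {#i#}) = computed_fun P x"
proof -
  define k where "k q i = (SOME K. \<forall>n\<ge>K. emit P i (fold (trans P) (replicate n i) q) = {#})" for q i
  have k: "emit P i (fold (trans P) (replicate n i) q) = {#}"
    if "q \<in> states P" "i \<in> inputs P" "n \<ge> k q i" for q i n
    using someI_ex[OF emit_eventually_empty[OF that(1,2)]] that(3) by (simp add: k_def)
  let ?S = "(\<lambda>(q, i). k q i) ` (states P \<times> inputs P)"
  have K: "k q i \<le> Max ?S" if "q \<in> states P" "i \<in> inputs P" for q i
    using that finite_states finite_inputs by (intro Max_ge) auto
  have "computed_fun P (x - {#i#}) = computed_fun P x"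
    if x: "set_mset x \<subseteq> inputs P" and i: "count x i > Max ?S" for x i
  proof -
    obtain n where n: "count x i = Suc n" using i by (cases "count x i") auto
    obtain w where w: "mset w = filter_mset (\<lambda>j. i \<noteq> j) x" using ex_mset by blast
    have "set w = set_mset (mset w)" by simp
    then have wx: "set w \<subseteq> inputs P" using x unfolding w by auto
    have ii: "i \<in> inputs P" using n x by (metis count_eq_zero_iff nat.distinct(1) subsetD)
    \<comment> \<open>All copies of \<open>i\<close> are delivered last, so the removed copy is the
      very last letter. It arrives after \<open>n\<close> other copies, and
      \<open>n \<ge> Max ?S\<close> because \<open>Suc n\<close> exceeds
      \<open>Max ?S\<close>.\<close>
    have x_eq: "x = mset w + replicate_mset (Suc n) i"
      using n w by (auto simp: multiset_eq_iff)
    let ?q = "fold (trans P) w (init P)"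
    have q: "?q \<in> states P" using wx by (simp add: fold_trans_in_states init_in_states)
    have "emit P i (fold (trans P) (replicate n i) ?q) = {#}"
      using k[OF q ii, of n] K[OF q ii] i n by simp
    then have "computed_fun P x = computed_fun P (mset w + replicate_mset n i)"
      using computed_fun_add_replicate[OF wx ii] x_eq
      by (simp only: total_output_replicate_Suc) simp
    then show ?thesis using x_eq by simp
  qed
  then show ?thesis using that by blast
qed

lemma saturation:
  obtains K where "\<And>x. set_mset x \<subseteq> inputs P \<Longrightarrow>
      \<exists>m. m \<subseteq># x \<and> (\<forall>i. count m i \<le> K) \<and> computed_fun P m = computed_fun P x"
proof -
  obtain K where K: "\<And>x i. set_mset x \<subseteq> inputs P \<Longrightarrow> count x i > K \<Longrightarrow>
      computed_fun P (x - {#i#}) = computed_fun P x"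
    using uniform_saturation by blast
  have "\<exists>m. m \<subseteq># x \<and> (\<forall>i. count m i \<le> K) \<and> computed_fun P m = computed_fun P x"
    if "set_mset x \<subseteq> inputs P" for x
    using that
  proof (induction "size x" arbitrary: x rule: less_induct)
    case less
    show ?case
    proof (cases "\<forall>i. count x i \<le> K")
      case False
      then obtain i where i: "count x i > K" by (auto simp: not_le)
      then have "0 < count x i" by linarith
      then have "i \<in># x" by simp
      then have "\<exists>m. m \<subseteq># x - {#i#} \<and> (\<forall>i. count m i \<le> K) \<and>
          computed_fun P m = computed_fun P (x - {#i#})"
        using less.prems by (intro less.hyps) (auto simp: size_Diff1_less dest: in_diffD)
      then obtain m where "m \<subseteq># x - {#i#}" "\<forall>i. count m i \<le> K"
          "computed_fun P m = computed_fun P (x - {#i#})" by blast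
      moreover from this(1) have "m \<subseteq># x"
        by (rule subset_mset.order_trans[OF _ diff_subset_eq_self])
      ultimately show ?thesis using K[OF less.prems i] by auto
    qed auto
  qed
  then show ?thesis using that by blast
qed

end

lemma finite_multisets_bounded_count:
  assumes "finite A"
  shows "finite {m. set_mset m \<subseteq> A \<and> (\<forall>a. count m a \<le> K)}"
proof (rule finite_subset)
  show "{m. set_mset m \<subseteq> A \<and> (\<forall>a. count m a \<le> K)}
      \<subseteq> mset ` {w. set w \<subseteq> A \<and> length w \<le> card A * K}"
  proof
    fix m assume "m \<in> {m. set_mset m \<subseteq> A \<and> (\<forall>a. count m a \<le> K)}"
    then have m: "set_mset m \<subseteq> A" "\<And>a. count m a \<le> K" by auto
    have "size m \<le> card (set_mset m) * K"
      using sum_bounded_above[of "set_mset m" "count m" K] m(2) by (simp add: size_multiset_overloaded_eq)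
    also have "\<dots> \<le> card A * K" using m(1) assms by (simp add: card_mono)
    finally have "size m \<le> card A * K" .
    moreover obtain w where "mset w = m" using ex_mset by blast
    ultimately show "m \<in> mset ` {w. set w \<subseteq> A \<and> length w \<le> card A * K}"
      using m(1) by force
  qed
  show "finite (mset ` {w. set w \<subseteq> A \<and> length w \<le> card A * K})"
    using finite_lists_length_le[OF assms] by simp
qed

section \<open>Monotone threshold logic without the constant 1\<close>

section \<open>Threshold functions\<close>

text \<open>Copying an edge leaves its function unchanged, hence no rule for splitters. The rule
  \<open>zero\<close> stands for a presink that starts in state 1; it asks for a term
  \<open>f\<close> because every gate has an incoming edge. All gate terms vanish at
  \<open>{#}\<close>, which rules out the constant 1.\<close>

inductive gate_term :: "'a set \<Rightarrow> ('a multiset \<Rightarrow> nat) \<Rightarrow> bool" for A where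
  input: "a \<in> A \<Longrightarrow> gate_term A (\<lambda>x. count x a)"
| add: "gate_term A f \<Longrightarrow> gate_term A g \<Longrightarrow> gate_term A (\<lambda>x. f x + g x)"
| delay: "gate_term A f \<Longrightarrow> gate_term A (\<lambda>x. f x - 1)"
| presink: "gate_term A f \<Longrightarrow> gate_term A (\<lambda>x. min 1 (f x))"
| zero: "gate_term A f \<Longrightarrow> gate_term A (\<lambda>_. 0)"

lemma gate_term_zero: "A \<noteq> {} \<Longrightarrow> gate_term A (\<lambda>_. 0)"
  using gate_term.input gate_term.zero by fast

lemma gate_term_sum:
  assumes "A \<noteq> {}" "finite S" "\<And>s. s \<in> S \<Longrightarrow> gate_term A (f s)"
  shows "gate_term A (\<lambda>x. \<Sum>s\<in>S. f s x)"
  using assms(2,3) by (induction S) (auto intro: gate_term_zero[OF assms(1)] gate_term.add)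

text \<open>The term consists of \<open>n - 1\<close> delayers in series and a presink. For
  \<open>n = 0\<close> the function would be the constant 1.\<close>

lemma gate_term_at_least:
  assumes "a \<in> A" "n > 0"
  shows "gate_term A (\<lambda>x. of_bool (n \<le> count x a))"
proof -
  have diff: "gate_term A (\<lambda>x. count x a - k)" for k
  proof (induction k)
    case (Suc k)
    from gate_term.delay[OF this] show ?case by simp
  qed (use assms gate_term.input in simp)
  have "(\<lambda>x. of_bool (n \<le> count x a)) = (\<lambda>x. min 1 (count x a - (n - 1)))"
    using assms(2) by (auto simp: fun_eq_iff of_bool_def)
  then show ?thesis using gate_term.presink[OF diff] by simp
qed

lemma gate_term_conj:
  assumes "gate_term A (\<lambda>x. of_bool (p x))" "gate_term A (\<lambda>x. of_bool (q x))"
  shows "gate_term A (\<lambda>x. of_bool (p x \<and> q x))"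
proof -
  have "(\<lambda>x. of_bool (p x \<and> q x)) = (\<lambda>x. of_bool (p x) + of_bool (q x) - (1 :: nat))"
    by (auto simp: fun_eq_iff)
  then show ?thesis using gate_term.delay[OF gate_term.add[OF assms]] by simp
qed

text \<open>\<open>S\<close> is nonempty because the empty conjunction is the constant 1.\<close>

lemma gate_term_Ball:
  assumes "finite S" "S \<noteq> {}" "\<And>s. s \<in> S \<Longrightarrow> gate_term A (\<lambda>x. of_bool (p s x))"
  shows "gate_term A (\<lambda>x. of_bool (\<forall>s\<in>S. p s x))"
  using assms by (induction S rule: finite_ne_induct) (auto intro: gate_term_conj)

lemma gate_term_Bex:
  assumes "A \<noteq> {}" "finite S" "\<And>s. s \<in> S \<Longrightarrow> gate_term A (\<lambda>x. of_bool (p s x))"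
  shows "gate_term A (\<lambda>x. of_bool (\<exists>s\<in>S. p s x))"
proof -
  have "(\<lambda>x. of_bool (\<exists>s\<in>S. p s x)) = (\<lambda>x. min 1 (\<Sum>s\<in>S. of_bool (p s x) :: nat))"
  proof
    fix x
    show "of_bool (\<exists>s\<in>S. p s x) = min 1 (\<Sum>s\<in>S. of_bool (p s x) :: nat)"
    proof (cases "\<exists>s\<in>S. p s x")
      case True
      then obtain s where "s \<in> S" "p s x" by blast
      then have "(\<Sum>s\<in>S. of_bool (p s x) :: nat) \<ge> 1"
        using member_le_sum[of s S "\<lambda>s. of_bool (p s x) :: nat"] assms(2) by simp
      then show ?thesis using True by simp
    qed simp
  qed
  then show ?thesis using gate_term.presink[OF gate_term_sum[OF assms]] by simp
qed

lemma (in bounded_finite_abelian_processor) output_gate_term: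
  assumes "inputs P \<noteq> {}"
  shows "\<exists>f. gate_term (inputs P) f \<and>
    (\<forall>x. set_mset x \<subseteq> inputs P \<longrightarrow> f x = count (computed_fun P x) b)"
proof -
  let ?A = "inputs P" and ?F = "\<lambda>x. count (computed_fun P x) b"
  obtain K where K: "\<And>x. set_mset x \<subseteq> ?A \<Longrightarrow>
      \<exists>m. m \<subseteq># x \<and> (\<forall>i. count m i \<le> K) \<and> computed_fun P m = computed_fun P x"
    using saturation by blast
  obtain C where C: "\<And>x. set_mset x \<subseteq> ?A \<Longrightarrow> size (computed_fun P x) \<le> C"
    using size_computed_fun_bounded by blast
  define box where "box c = {m. set_mset m \<subseteq> ?A \<and> (\<forall>a. count m a \<le> K)} \<inter> {m. c < ?F m}" for c
  \<comment> \<open>The value is written in unary: a multiplicity is at most the size, so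
    \<open>C\<close> bits suffice. Quantifying over \<open>set_mset m\<close> only still expresses
    \<open>m \<subseteq># x\<close> and keeps all thresholds positive.\<close>
  define f where "f x = (\<Sum>c<C. of_bool (\<exists>m\<in>box c. \<forall>a\<in>set_mset m. count m a \<le> count x a) :: nat)" for x
  \<comment> \<open>Members of \<open>box c\<close> are nonempty because \<open>?F {#} = 0\<close>; the constant 1 is not a gate term.\<close>
  have "gate_term ?A (\<lambda>x. of_bool (\<exists>m\<in>box c. \<forall>a\<in>set_mset m. count m a \<le> count x a))" for c
  proof (intro gate_term_Bex gate_term_Ball gate_term_at_least assms)
    show "finite (box c)"
      unfolding box_def by (intro finite_Int disjI1 finite_multisets_bounded_count finite_inputs)
  qed (auto simp: box_def)
  then have "gate_term ?A f"
    unfolding f_def by (intro gate_term_sum assms) auto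
  moreover have "f x = ?F x" if x: "set_mset x \<subseteq> ?A" for x
  proof -
    have "(\<exists>m\<in>box c. \<forall>a\<in>set_mset m. count m a \<le> count x a) \<longleftrightarrow> c < ?F x" for c
    proof
      assume "\<exists>m\<in>box c. \<forall>a\<in>set_mset m. count m a \<le> count x a"
      then obtain m where m: "m \<in> box c" "\<forall>a\<in>set_mset m. count m a \<le> count x a" by blast
      have "count m a \<le> count x a" for a
        using m(2) by (cases "a \<in># m") (auto simp: not_in_iff)
      then have "m \<subseteq># x" by (rule mset_subset_eqI)
      then have "?F m \<le> ?F x" using computed_fun_mono[OF x] by (simp add: mset_subset_eq_count)
      then show "c < ?F x" using m(1) by (simp add: box_def)
    next
      assume c: "c < ?F x"
      obtain m where "m \<subseteq># x" "\<forall>i. count m i \<le> K" "computed_fun P m = computed_fun P x"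
        using K[OF x] by blast
      then show "\<exists>m\<in>box c. \<forall>a\<in>set_mset m. count m a \<le> count x a"
        using c x by (intro bexI[of _ m]) (auto simp: box_def mset_subset_eq_count dest: set_mset_mono)
    qed
    then have "f x = (\<Sum>c<C. of_bool (c < ?F x))" by (simp add: f_def)
    also have "\<dots> = card ({..<C} \<inter> {c. c < ?F x})" by simp
    also have "{..<C} \<inter> {c. c < ?F x} = {..<?F x}"
      using C[OF x] count_le_size[of "computed_fun P x" b] by auto
    finally show ?thesis by simp
  qed
  ultimately show ?thesis by blast
qed

section \<open>Balance equations for edge loads, compared with executions\<close>

section \<open>Flows of acyclic networks\<close>

text \<open>\<open>V\<close> is meant to count the letters placed on each edge during a whole run,
  including those processed later. The equations relate edges only; neither current states nor an
  order of processing occur in them.\<close>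

definition flow :: "('v, 'e, 's) network \<Rightarrow> 'e multiset \<Rightarrow> 'e multiset \<Rightarrow> bool" where
  "flow N x V \<longleftrightarrow> set_mset V \<subseteq> edges N \<and> {#e \<in># V. tail N e = None#} = x \<and>
     (\<forall>v \<in> nodes N. {#e \<in># V. tail N e = Some v#}
        = computed_fun (proc N v) {#e \<in># V. head N e = Some v#})"

context abelian_network
begin

lemma abelian_proc: "v \<in> nodes N \<Longrightarrow> abelian_processor (proc N v)"
  using proc_abelian finite_abelian_processor.axioms(1) by blast

text \<open>Induction downstream: an edge may rely on all edges into its tail. It is well-founded
  because the adjacency relation is finite and acyclic.\<close>

lemma edge_induct [consumes 2, case_names input internal]:
  assumes "directed_acyclic N" "e \<in> edges N"
    and input: "\<And>e. e \<in> edges N \<Longrightarrow> tail N e = None \<Longrightarrow> Q e"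
    and internal: "\<And>e v. e \<in> edges N \<Longrightarrow> tail N e = Some v \<Longrightarrow>
      (\<And>d. d \<in> edges N \<Longrightarrow> head N d = Some v \<Longrightarrow> Q d) \<Longrightarrow> Q e"
  shows "Q e"
proof -
  define R where "R = {(u, v). \<exists>e \<in> edges N. tail N e = Some u \<and> head N e = Some v}"
  have "R \<subseteq> nodes N \<times> nodes N"
    using tail_in_nodes head_in_nodes by (auto simp: R_def)
  then have "finite R" using finite_nodes by (meson finite_SigmaI finite_subset)
  then have wf: "wf R"
    using assms(1) by (simp add: finite_acyclic_wf directed_acyclic_def R_def)
  have *: "\<forall>e \<in> edges N. tail N e = Some v \<longrightarrow> Q e" for v
    using wf
  proof (induction v rule: wf_induct_rule)
    case (less v)
    show ?case
    proof (intro ballI impI)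
      fix e assume e: "e \<in> edges N" "tail N e = Some v"
      show "Q e"
      proof (rule internal[OF e])
        fix d assume d: "d \<in> edges N" "head N d = Some v"
        show "Q d"
        proof (cases "tail N d")
          case (Some u)
          then have "(u, v) \<in> R" using d by (auto simp: R_def)
          then show ?thesis using less.IH d Some by blast
        qed (use input d in blast)
      qed
    qed
  qed
  show ?thesis
  proof (cases "tail N e")
    case (Some v)
    then show ?thesis using * assms(2) by blast
  qed (use input assms(2) in blast)
qed

lemma set_into_inputs:
  "set_mset M \<subseteq> edges N \<Longrightarrow> v \<in> nodes N \<Longrightarrow>
     set_mset {#e \<in># M. head N e = Some v#} \<subseteq> inputs (proc N v)"
  by (auto simp: proc_inputs incoming_def)

text \<open>\<open>M\<close> plays the letters placed so far and \<open>p\<close> those processed so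
  far. A node has answered only \<open>p\<close>, which by induction is below \<open>V\<close> on
  its incoming edges, so monotonicity of \<open>computed_fun\<close> bounds what it has emitted.
  With \<open>p = M\<close> this compares two flows.\<close>

lemma balanced_le_flow:
  assumes "directed_acyclic N" "flow N x V" "p \<subseteq># M" "set_mset M \<subseteq> edges N"
    and tail_None: "{#e \<in># M. tail N e = None#} = x"
    and tail_Some: "\<And>v. v \<in> nodes N \<Longrightarrow>
      {#e \<in># M. tail N e = Some v#} = computed_fun (proc N v) {#e \<in># p. head N e = Some v#}"
  shows "M \<subseteq># V"
proof (rule mset_subset_eqI)
  fix e
  show "count M e \<le> count V e"
  proof (cases "e \<in> edges N")
    case True
    with assms(1) show ?thesis
    proof (induction rule: edge_induct)
      case (input e)
      have "{#d \<in># M. tail N d = tail N e#} = {#d \<in># V. tail N d = tail N e#}"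
        using input.hyps(2) tail_None conjunct1[OF conjunct2[OF assms(2)[unfolded flow_def]]]
        by simp
      from arg_cong[OF this, of "\<lambda>X. count X e"] show ?case by simp
    next
      case (internal e v)
      have v: "v \<in> nodes N" using internal.hyps tail_in_nodes by blast
      interpret abelian_processor "proc N v" using v by (rule abelian_proc)
      have "count p d \<le> count V d" if "head N d = Some v" for d
      proof (cases "d \<in> edges N")
        case True
        then show ?thesis
          using internal.IH[OF True that] mset_subset_eq_count[OF assms(3), of d] by linarith
      next
        case False
        then have "d \<notin># p" using mset_subset_eqD[OF assms(3)] assms(4) by blast
        then show ?thesis by (simp add: not_in_iff)
      qed
      then have "{#d \<in># p. head N d = Some v#} \<subseteq># {#d \<in># V. head N d = Some v#}"
        by (intro mset_subset_eqI) simp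
      moreover have V: "set_mset V \<subseteq> edges N" "{#d \<in># V. tail N d = Some v#}
          = computed_fun (proc N v) {#d \<in># V. head N d = Some v#}"
        using assms(2) v by (auto simp: flow_def)
      ultimately have "{#d \<in># M. tail N d = Some v#} \<subseteq># {#d \<in># V. tail N d = Some v#}"
        unfolding tail_Some[OF v] V(2) by (intro computed_fun_mono set_into_inputs[OF V(1) v])
      then show ?case
        using mset_subset_eq_count[of "{#d \<in># M. tail N d = Some v#}"
            "{#d \<in># V. tail N d = Some v#}" e] internal.hyps by simp
    qed
  next
    case False
    then have "e \<notin># M" using assms(4) by blast
    then show ?thesis by (simp add: not_in_iff)
  qed
qed

lemma flow_unique:
  assumes "directed_acyclic N" "flow N x V" "flow N x V'"
  shows "V = V'"
proof (rule subset_mset.antisym)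
  show "V \<subseteq># V'"
    using assms by (intro balanced_le_flow[OF assms(1,3) subset_mset.order_refl]) (auto simp: flow_def)
  show "V' \<subseteq># V"
    using assms by (intro balanced_le_flow[OF assms(1,2) subset_mset.order_refl]) (auto simp: flow_def)
qed

end

text \<open>
  \<open>w v\<close> is the word that the processor at \<open>v\<close> has received so far and \<open>p\<close> the multiset of all
  letters processed so far, so that \<open>snd c + p\<close> counts the letters ever placed on each edge.
\<close>

definition history ::
    "('v, 'e, 's) network \<Rightarrow> 'e multiset \<Rightarrow> ('v, 'e, 's) config \<Rightarrow> ('v \<Rightarrow> 'e list) \<Rightarrow> 'e multiset \<Rightarrow> bool"
  where
  "history N x c w p \<longleftrightarrow> set_mset (snd c + p) \<subseteq> edges N \<and> (\<forall>e \<in># p. head N e \<noteq> None) \<and>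
     {#e \<in># snd c + p. tail N e = None#} = x \<and>
     (\<forall>v \<in> nodes N. mset (w v) = {#e \<in># p. head N e = Some v#} \<and>
        fst c v = fold (trans (proc N v)) (w v) (init (proc N v)) \<and>
        {#e \<in># snd c + p. tail N e = Some v#}
          = total_output (proc N v) (init (proc N v)) (w v))"

context abelian_network
begin

lemma history_start:
  assumes "set_mset x \<subseteq> input_edges N"
  shows "history N x (start_config N x) (\<lambda>_. []) {#}"
proof -
  have "tail N e = None" if "e \<in># x" for e
    using that assms dangling_edges tail_None_iff by blast
  then show ?thesis
    using assms dangling_edges
    by (auto simp: history_def start_config_def filter_mset_eq_conv)
qed

lemma history_word:
  assumes "history N x c w p" "v \<in> nodes N"
  shows "set (w v) \<subseteq> inputs (proc N v)"
proof -
  have "set (w v) = set_mset {#e \<in># p. head N e = Some v#}"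
    using assms by (simp add: history_def flip: set_mset_mset)
  then show ?thesis using set_into_inputs[of p v] assms by (simp add: history_def)
qed

lemma history_balance:
  assumes "history N x c w p" "v \<in> nodes N"
  shows "{#e \<in># snd c + p. tail N e = Some v#}
      = computed_fun (proc N v) {#e \<in># p. head N e = Some v#}"
proof -
  interpret abelian_processor "proc N v" using assms(2) by (rule abelian_proc)
  show ?thesis
    using total_output_eq_computed_fun[OF history_word[OF assms]] assms by (simp add: history_def)
qed

lemma history_step:
  assumes "step N c c'" "history N x c w p"
  shows "\<exists>w' p'. history N x c' w' p' \<and> size p' = Suc (size p)"
  using assms(1)
proof cases
  case (1 e L v \<sigma>)
  have e: "e \<in> edges N" using assms(2) 1 by (auto simp: history_def)
  have v: "v \<in> nodes N" using head_in_nodes[OF e] 1 by blast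
  interpret abelian_processor "proc N v" using v by (rule abelian_proc)
  have \<sigma>: "\<sigma> v = fold (trans (proc N v)) (w v) (init (proc N v))"
    using assms(2) v 1 by (auto simp: history_def)
  have "\<sigma> v \<in> states (proc N v)"
    unfolding \<sigma> by (intro fold_trans_in_states init_in_states history_word[OF assms(2) v])
  moreover have "e \<in> inputs (proc N v)" using e 1 v by (simp add: proc_inputs incoming_def)
  ultimately have emitted: "set_mset (emit (proc N v) e (\<sigma> v)) \<subseteq> outgoing N v"
    using emit_in_outputs proc_outputs[OF v] by blast
  let ?E = "emit (proc N v) e (\<sigma> v)"
  \<comment> \<open>Moving \<open>e\<close> from the waiting to the processed letters leaves their
    sum unchanged, so a step adds just the emitted letters, all on edges out of
    \<open>v\<close>.\<close>
  have total: "L - {#e#} + ?E + add_mset e p = L + p + ?E" using 1 by simp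
  have tails: "{#d \<in># ?E. tail N d = t#} = (if t = Some v then ?E else {#})" for t
    using emitted by (auto simp: outgoing_def filter_mset_eq_conv)
  have "history N x c' (w(v := w v @ [e])) (add_mset e p)"
    unfolding history_def 1(2) fst_conv snd_conv total
    using assms(2) emitted e v \<sigma> 1
    by (auto simp: history_def tails tails[unfolded \<sigma>] outgoing_def total_output_append)
  then show ?thesis by (intro exI conjI) (assumption, simp)
qed

lemma history_le_flow:
  assumes "directed_acyclic N" "flow N x V" "history N x c w p"
  shows "snd c + p \<subseteq># V"
proof (rule balanced_le_flow[OF assms(1,2), of p])
  show "p \<subseteq># snd c + p" by simp
qed (use assms(3) history_balance[OF assms(3)] in \<open>auto simp: history_def\<close>)

text \<open>The letters left in a halted configuration lie on edges without head, so every node has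
  received all that was ever placed on its incoming edges.\<close>

lemma history_halted_flow:
  assumes "history N x c w p" "halted N c"
  shows "flow N x (snd c + p)"
  unfolding flow_def
proof (intro conjI ballI)
  fix v assume v: "v \<in> nodes N"
  have "head N e = None" if "e \<in># snd c" for e
    using that assms head_None_iff unfolding history_def halted_def by auto
  then have into: "{#e \<in># snd c + p. head N e = Some v#} = {#e \<in># p. head N e = Some v#}"
    by auto
  show "{#e \<in># snd c + p. tail N e = Some v#}
      = computed_fun (proc N v) {#e \<in># snd c + p. head N e = Some v#}"
    unfolding into by (rule history_balance[OF assms(1) v])
qed (use assms(1) in \<open>auto simp: history_def\<close>)

theorem halts_with_output_flow:
  assumes "directed_acyclic N" "set_mset x \<subseteq> input_edges N" "flow N x V"
  shows "halts_with_output N x {#e \<in># V. e \<in> output_edges N#}"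
  unfolding halts_with_output_def
proof (intro conjI allI impI notI)
  assume "\<exists>c. c 0 = start_config N x \<and> (\<forall>n. step N (c n) (c (Suc n)))"
  then obtain c where "c 0 = start_config N x \<and> (\<forall>n. step N (c n) (c (Suc n)))" ..
  then have c: "c 0 = start_config N x" "\<And>n. step N (c n) (c (Suc n))" by simp_all
  \<comment> \<open>Every step processes exactly one letter, so after \<open>Suc (size V)\<close>
    steps more letters are processed than \<open>V\<close> contains.\<close>
  have bounded: "\<exists>w p. history N x (c n) w p \<and> size p = n" for n
  proof (induction n)
    case 0
    show ?case
      unfolding c(1) by (intro exI conjI) (rule history_start[OF assms(2)], simp)
  next
    case (Suc n)
    then obtain w p where p: "history N x (c n) w p" "size p = n" by blast
    show ?case using history_step[OF c(2) p(1)] unfolding p(2) .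
  qed
  obtain w p where p: "history N x (c (Suc (size V))) w p" "size p = Suc (size V)"
    using bounded[of "Suc (size V)"] by blast
  then show False
    using size_mset_mono[OF history_le_flow[OF assms(1,3) p(1)]] by simp
next
  fix c assume c: "(step N)\<^sup>*\<^sup>* (start_config N x) c \<and> halted N c"
  have "\<exists>w p. history N x c w p"
    using conjunct1[OF c]
  proof (induction rule: rtranclp_induct)
    case base
    then show ?case using history_start[OF assms(2)] by blast
  next
    case (step c c')
    then obtain w p where "history N x c w p" by blast
    then show ?case using history_step[OF step.hyps(2)] by blast
  qed
  then obtain w p where p: "history N x c w p" by blast
  have V: "V = snd c + p"
    by (rule flow_unique[OF assms(1,3) history_halted_flow[OF p conjunct2[OF c]]])
  \<comment> \<open>An output edge has no head, so nothing on it is ever processed: its load is what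
    lies there at the end.\<close>
  have "set_mset p \<subseteq> edges N" "\<forall>e \<in># p. head N e \<noteq> None"
    using p by (simp_all add: history_def)
  then have "e \<notin> output_edges N" if "e \<in># p" for e
    using that head_None_iff by blast
  then show "{#e \<in># snd c. e \<in> output_edges N#} = {#e \<in># V. e \<in> output_edges N#}"
    unfolding V by auto
qed

end

section \<open>Gates as functions of the total load, and growth at output edges\<close>

section \<open>Circuits\<close>

definition is_gate :: "('a, 'b, nat) processor \<Rightarrow> bool" where
  "is_gate G \<longleftrightarrow> is_adder G \<or> is_splitter G \<or> is_delayer G \<or> is_presink G"

text \<open>In every gate the number of letters emitted on each output edge depends only on the total
  number of letters received.\<close>

definition gate_computes :: "nat \<Rightarrow> nat \<Rightarrow> (nat \<Rightarrow> nat) \<Rightarrow> bool" where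
  "gate_computes p q h \<longleftrightarrow>
     (\<forall>I K :: nat set. card I = p \<longrightarrow> card K = q \<longrightarrow>
        (\<exists>G :: (nat, nat, nat) processor. finite_abelian_processor G \<and> is_gate G \<and>
           inputs G = I \<and> outputs G = K \<and>
           (\<forall>y. set_mset y \<subseteq> I \<longrightarrow> (\<forall>k \<in> K. count (computed_fun G y) k = h (size y)))))"

lemma gate_computesI:
  fixes h :: "nat \<Rightarrow> nat"
  assumes "\<And>I K :: nat set. card I = p \<Longrightarrow> card K = q \<Longrightarrow>
    \<exists>G :: (nat, nat, nat) processor. finite_abelian_processor G \<and> is_gate G \<and>
      inputs G = I \<and> outputs G = K \<and>
      (\<forall>w. set w \<subseteq> I \<longrightarrow> (\<forall>k \<in> K. count (total_output G (init G) w) k = h (length w)))"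
  shows "gate_computes p q h"
  unfolding gate_computes_def
proof (intro allI impI)
  fix I K :: "nat set" assume "card I = p" "card K = q"
  then obtain G where G: "finite_abelian_processor G" "is_gate G" "inputs G = I" "outputs G = K"
    "\<And>w k. set w \<subseteq> I \<Longrightarrow> k \<in> K \<Longrightarrow> count (total_output G (init G) w) k = h (length w)"
    using assms[of I K] by blast
  interpret finite_abelian_processor G by fact
  have "count (computed_fun G y) k = h (size y)" if "set_mset y \<subseteq> I" "k \<in> K" for y k
  proof -
    obtain w where w: "mset w = y" using ex_mset by blast
    then have "set w \<subseteq> I" using that(1) by auto
    then have "total_output G (init G) w = computed_fun G y"
      using total_output_eq_computed_fun[of w] by (simp add: w G(3))
    moreover have "size y = length w" by (simp flip: w)
    ultimately show ?thesis using G(5)[OF \<open>set w \<subseteq> I\<close> that(2)] by simp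
  qed
  then show "\<exists>G. finite_abelian_processor G \<and> is_gate G \<and> inputs G = I \<and> outputs G = K \<and>
      (\<forall>y. set_mset y \<subseteq> I \<longrightarrow> (\<forall>k \<in> K. count (computed_fun G y) k = h (size y)))"
    using G(1-4) by blast
qed

text \<open>Adder and splitter in one: each received letter puts one letter on every outgoing edge,
  and the sizes of \<open>I\<close> and \<open>K\<close> decide which of the two it is.\<close>

definition stateless_gate :: "'a set \<Rightarrow> 'b set \<Rightarrow> ('a, 'b, nat) processor" where
  "stateless_gate I K = \<lparr>inputs = I, outputs = K, states = {0}, init = 0,
     trans = (\<lambda>_ _. 0), emit = (\<lambda>_ _. mset_set K)\<rparr>"

text \<open>The start state is a parameter because state 1 is used too: a delayer started there
  passes every letter on, and a presink started there stays silent.\<close>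

definition delayer :: "nat \<Rightarrow> 'a \<Rightarrow> 'b \<Rightarrow> ('a, 'b, nat) processor" where
  "delayer s i k = \<lparr>inputs = {i}, outputs = {k}, states = {0, 1}, init = s,
     trans = (\<lambda>_ _. 1), emit = (\<lambda>_ q. if q = 0 then {#} else {#k#})\<rparr>"

definition presink :: "nat \<Rightarrow> 'a \<Rightarrow> 'b \<Rightarrow> ('a, 'b, nat) processor" where
  "presink s i k = \<lparr>inputs = {i}, outputs = {k}, states = {0, 1}, init = s,
     trans = (\<lambda>_ _. 1), emit = (\<lambda>_ q. if q = 0 then {#k#} else {#})\<rparr>"

lemma delayer_simps [simp]:
  "inputs (delayer s i k) = {i}" "outputs (delayer s i k) = {k}" "init (delayer s i k) = s"
  by (simp_all add: delayer_def)

lemma presink_simps [simp]: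
  "inputs (presink s i k) = {i}" "outputs (presink s i k) = {k}" "init (presink s i k) = s"
  by (simp_all add: presink_def)

lemma stateless_gate_abelian:
  "finite I \<Longrightarrow> finite K \<Longrightarrow> finite_abelian_processor (stateless_gate I K)"
  by unfold_locales (auto simp: stateless_gate_def)

lemma delayer_abelian: "s \<in> {0, 1} \<Longrightarrow> finite_abelian_processor (delayer s i k)"
  by unfold_locales (auto simp: delayer_def)

lemma presink_abelian: "s \<in> {0, 1} \<Longrightarrow> finite_abelian_processor (presink s i k)"
  by unfold_locales (auto simp: presink_def)

lemma count_total_output_stateless_gate:
  "finite K \<Longrightarrow> k \<in> K \<Longrightarrow> count (total_output (stateless_gate I K) q w) k = length w"
  by (induction w arbitrary: q) (auto simp: stateless_gate_def)

lemma total_output_delayer_1: "total_output (delayer s i k) 1 w = replicate_mset (length w) k"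
  by (induction w) (auto simp: delayer_def)

lemma total_output_delayer_0: "total_output (delayer s i k) 0 w = replicate_mset (length w - 1) k"
  using total_output_delayer_1[of s i k] by (cases w) (auto simp: delayer_def)

lemma total_output_presink_1: "total_output (presink s i k) 1 w = {#}"
  by (induction w) (auto simp: presink_def)

lemma total_output_presink_0: "total_output (presink s i k) 0 w = replicate_mset (min 1 (length w)) k"
  using total_output_presink_1[of s i k] by (cases w) (auto simp: presink_def)

lemma gate_computes_add: "gate_computes 2 1 (\<lambda>n. n)"
proof (rule gate_computesI)
  fix I K :: "nat set" assume IK: "card I = 2" "card K = 1"
  then obtain i j k where "I = {i, j}" "i \<noteq> j" "K = {k}"
    by (auto simp: card_2_iff card_1_singleton_iff)
  then have "is_gate (stateless_gate I K)"
    by (auto simp: is_gate_def is_adder_def stateless_gate_def)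
  moreover have "finite I" "finite K" using IK by (auto intro: card_ge_0_finite)
  ultimately show "\<exists>G. finite_abelian_processor G \<and> is_gate G \<and> inputs G = I \<and> outputs G = K \<and>
      (\<forall>w. set w \<subseteq> I \<longrightarrow> (\<forall>k \<in> K. count (total_output G (init G) w) k = length w))"
    using stateless_gate_abelian[of I K] count_total_output_stateless_gate[of K _ I]
    by (intro exI[of _ "stateless_gate I K"]) (auto simp: stateless_gate_def)
qed

lemma gate_computes_split: "gate_computes 1 2 (\<lambda>n. n)"
proof (rule gate_computesI)
  fix I K :: "nat set" assume IK: "card I = 1" "card K = 2"
  then obtain i k l where "I = {i}" "k \<noteq> l" "K = {k, l}"
    by (auto simp: card_2_iff card_1_singleton_iff)
  then have "is_gate (stateless_gate I K)"
    by (auto simp: is_gate_def is_splitter_def stateless_gate_def)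
  moreover have "finite I" "finite K" using IK by (auto intro: card_ge_0_finite)
  ultimately show "\<exists>G. finite_abelian_processor G \<and> is_gate G \<and> inputs G = I \<and> outputs G = K \<and>
      (\<forall>w. set w \<subseteq> I \<longrightarrow> (\<forall>k \<in> K. count (total_output G (init G) w) k = length w))"
    using stateless_gate_abelian[of I K] count_total_output_stateless_gate[of K _ I]
    by (intro exI[of _ "stateless_gate I K"]) (auto simp: stateless_gate_def)
qed

lemma is_gate_delayer: "s \<in> {0, 1} \<Longrightarrow> is_gate (delayer s i k)"
  by (auto simp: is_gate_def is_delayer_def delayer_def)

lemma is_gate_presink: "s \<in> {0, 1} \<Longrightarrow> is_gate (presink s i k)"
  by (auto simp: is_gate_def is_presink_def presink_def)

lemma gate_computes_1_1I:
  assumes "\<And>i k :: nat. \<exists>G :: (nat, nat, nat) processor. finite_abelian_processor G \<and>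
    is_gate G \<and> inputs G = {i} \<and> outputs G = {k} \<and> (\<forall>w. total_output G (init G) w = replicate_mset (h (length w)) k)"
  shows "gate_computes 1 1 h"
proof (rule gate_computesI)
  fix I K :: "nat set" assume "card I = 1" "card K = 1"
  then obtain i k where IK: "I = {i}" "K = {k}" by (auto simp: card_1_singleton_iff)
  obtain G :: "(nat, nat, nat) processor" where "finite_abelian_processor G" "is_gate G"
      "inputs G = {i}" "outputs G = {k}"
      "\<And>w. total_output G (init G) w = replicate_mset (h (length w)) k"
    using assms[of i k] by blast
  then show "\<exists>G. finite_abelian_processor G \<and> is_gate G \<and> inputs G = I \<and> outputs G = K \<and>
      (\<forall>w. set w \<subseteq> I \<longrightarrow> (\<forall>k \<in> K. count (total_output G (init G) w) k = h (length w)))"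
    unfolding IK by (intro exI[of _ G]) simp
qed

lemma gate_computes_delay: "gate_computes 1 1 (\<lambda>n. n - 1)"
proof (rule gate_computes_1_1I)
  fix i k :: nat
  show "\<exists>G. finite_abelian_processor G \<and> is_gate G \<and> inputs G = {i} \<and> outputs G = {k} \<and>
      (\<forall>w. total_output G (init G) w = replicate_mset (length w - 1) k)"
    by (intro exI[of _ "delayer 0 i k"])
      (simp add: delayer_abelian is_gate_delayer total_output_delayer_0)
qed

lemma gate_computes_presink: "gate_computes 1 1 (\<lambda>n. min 1 n)"
proof (rule gate_computes_1_1I)
  fix i k :: nat
  show "\<exists>G. finite_abelian_processor G \<and> is_gate G \<and> inputs G = {i} \<and> outputs G = {k} \<and>
      (\<forall>w. total_output G (init G) w = replicate_mset (min 1 (length w)) k)"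
    by (intro exI[of _ "presink 0 i k"])
      (simp add: presink_abelian is_gate_presink total_output_presink_0)
qed

lemma gate_computes_zero: "gate_computes 1 1 (\<lambda>_. 0)"
proof (rule gate_computes_1_1I)
  fix i k :: nat
  show "\<exists>G. finite_abelian_processor G \<and> is_gate G \<and> inputs G = {i} \<and> outputs G = {k} \<and>
      (\<forall>w. total_output G (init G) w = replicate_mset 0 k)"
    by (intro exI[of _ "presink 1 i k"])
      (simp add: presink_abelian is_gate_presink total_output_presink_1[simplified])
qed

text \<open>Acyclicity is recorded as a topological numbering of the nodes. A new node with the
  largest number preserves it by a check on single edges, without any argument about paths.\<close>

definition circuit :: "(nat, nat, nat) network \<Rightarrow> bool" where
  "circuit N \<longleftrightarrow> abelian_network N \<and> (\<forall>v \<in> nodes N. is_gate (proc N v)) \<and>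
     (\<forall>e \<in> edges N. \<forall>u v. tail N e = Some u \<longrightarrow> head N e = Some v \<longrightarrow> u < v)"

lemma circuit_directed_acyclic:
  assumes "circuit N" shows "directed_acyclic N"
proof -
  have "{(u, v). \<exists>e\<in>edges N. tail N e = Some u \<and> head N e = Some v} \<subseteq> less_than"
    using assms by (auto simp: circuit_def)
  then show ?thesis
    unfolding directed_acyclic_def by (rule acyclic_subset[OF wf_acyclic[OF wf_less_than]])
qed

text \<open>The outgoing edges of \<open>G\<close> are meant to be fresh and its incoming edges to
  be output edges of \<open>N\<close>. Then nothing leads from \<open>v\<close> back to an old
  node.\<close>

definition attach :: "('v, 'e, 's) network \<Rightarrow> 'v \<Rightarrow> ('e, 'e, 's) processor \<Rightarrow> ('v, 'e, 's) network"
  where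
  "attach N v G = \<lparr>nodes = insert v (nodes N), edges = edges N \<union> outputs G,
     input_edges = input_edges N, output_edges = output_edges N - inputs G \<union> outputs G,
     trash_edges = trash_edges N,
     tail = (\<lambda>e. if e \<in> outputs G then Some v else tail N e),
     head = (\<lambda>e. if e \<in> outputs G then None else if e \<in> inputs G then Some v else head N e),
     proc = (proc N)(v := G)\<rparr>"

context
  fixes N :: "('v, 'e, 's) network" and v :: 'v and G :: "('e, 'e, 's) processor"
  assumes N: "abelian_network N" and G: "finite_abelian_processor G"
    and v: "v \<notin> nodes N" and I: "inputs G \<subseteq> output_edges N"
    and K: "outputs G \<inter> edges N = {}"
begin

interpretation N: abelian_network N by (fact N)
interpretation G: finite_abelian_processor G by (fact G)

lemma attach_disjoint: "inputs G \<inter> outputs G = {}" "inputs G \<inter> trash_edges N = {}"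
  "inputs G \<inter> input_edges N = {}"
  using I K N.dangling_edges N.disjoint_edges by blast+

lemma attach_not_into_v: "e \<in> edges N \<Longrightarrow> head N e \<noteq> Some v" "e \<in> edges N \<Longrightarrow> tail N e \<noteq> Some v"
  using N.head_in_nodes N.tail_in_nodes v by blast+

lemma attach_inputs_head: "e \<in> inputs G \<Longrightarrow> head N e = None"
  using I N.head_None_iff N.dangling_edges by blast

lemma attach_incoming:
  "u \<in> nodes N \<Longrightarrow> incoming (attach N v G) u = incoming N u"
  "incoming (attach N v G) v = inputs G"
  using attach_disjoint I K v attach_not_into_v N.dangling_edges
  by (auto simp: attach_inputs_head incoming_def attach_def split: if_splits)

lemma attach_outgoing:
  "u \<in> nodes N \<Longrightarrow> outgoing (attach N v G) u = outgoing N u"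
  "outgoing (attach N v G) v = outputs G"
  using K v attach_not_into_v by (auto simp: outgoing_def attach_def split: if_splits)

lemma attach_head_None_iff:
  assumes "e \<in> edges (attach N v G)"
  shows "head (attach N v G) e = None \<longleftrightarrow>
    e \<in> output_edges (attach N v G) \<union> trash_edges (attach N v G)"
  using assms attach_disjoint N.head_None_iff K by (auto simp: attach_def)

lemma attach_abelian_network: "abelian_network (attach N v G)"
proof (rule abelian_network.intro)
  show "finite (nodes (attach N v G))" "finite (edges (attach N v G))"
    using N.finite_nodes N.finite_edges G.finite_outputs by (simp_all add: attach_def)
  show "input_edges (attach N v G) \<subseteq> edges (attach N v G)"
    "output_edges (attach N v G) \<subseteq> edges (attach N v G)"
    "trash_edges (attach N v G) \<subseteq> edges (attach N v G)"
    using N.dangling_edges by (auto simp: attach_def)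
  show "input_edges (attach N v G) \<inter> output_edges (attach N v G) = {}"
    "input_edges (attach N v G) \<inter> trash_edges (attach N v G) = {}"
    "output_edges (attach N v G) \<inter> trash_edges (attach N v G) = {}"
    using N.dangling_edges N.disjoint_edges K by (auto simp: attach_def)
  show "e \<in> edges (attach N v G) \<Longrightarrow>
      (tail (attach N v G) e = None) = (e \<in> input_edges (attach N v G))" for e
    using N.dangling_edges N.tail_None_iff K by (auto simp: attach_def)
  show "e \<in> edges (attach N v G) \<Longrightarrow> tail (attach N v G) e = Some u \<Longrightarrow> u \<in> nodes (attach N v G)"
    for e u using N.tail_in_nodes by (auto simp: attach_def split: if_splits)
  show "e \<in> edges (attach N v G) \<Longrightarrow> head (attach N v G) e = Some u \<Longrightarrow> u \<in> nodes (attach N v G)"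
    for e u using N.head_in_nodes by (auto simp: attach_def split: if_splits)
  fix u assume "u \<in> nodes (attach N v G)"
  then consider "u = v" | "u \<in> nodes N" "u \<noteq> v" using v by (auto simp: attach_def)
  note cases = this
  have proc: "proc (attach N v G) = (proc N)(v := G)" by (simp add: attach_def)
  from cases show "finite_abelian_processor (proc (attach N v G) u)"
    by cases (simp_all add: proc G N.proc_abelian)
  from cases show "inputs (proc (attach N v G) u) = incoming (attach N v G) u"
    by cases (simp_all add: proc attach_incoming N.proc_inputs)
  from cases show "outputs (proc (attach N v G) u) = outgoing (attach N v G) u"
    by cases (simp_all add: proc attach_outgoing N.proc_outputs)
qed (rule attach_head_None_iff)

text \<open>No fresh edge enters an old node, so the old loads stay valid and only the response of
  \<open>G\<close> is added. Flows thus exist by construction and need not be extracted from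
  executions.\<close>

lemma attach_flow:
  assumes V: "flow N x V"
  defines "V' \<equiv> V + computed_fun G {#e \<in># V. e \<in> inputs G#}"
  shows "flow (attach N v G) x V'"
proof -
  have edges: "set_mset V \<subseteq> edges N" using V by (simp add: flow_def)
  let ?E = "computed_fun G {#e \<in># V. e \<in> inputs G#}"
  have E: "set_mset ?E \<subseteq> outputs G" by (rule G.computed_fun_in_outputs) auto
  \<comment> \<open>The edges in \<open>inputs G\<close> had no head before, so handing them to
    \<open>v\<close> takes letters from no other node.\<close>
  have head_V: "{#e \<in># V. head (attach N v G) e = Some u#}
      = (if u = v then {#e \<in># V. e \<in> inputs G#} else {#e \<in># V. head N e = Some u#})" for u
  proof -
    have "head (attach N v G) e = Some u \<longleftrightarrow>
        (if u = v then e \<in> inputs G else head N e = Some u)" if "e \<in># V" for e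
    proof -
      have "e \<in> edges N" using that edges by blast
      then have "head (attach N v G) e = (if e \<in> inputs G then Some v else head N e)"
        using K by (auto simp: attach_def)
      then show ?thesis
        using attach_not_into_v(1)[OF \<open>e \<in> edges N\<close>] attach_inputs_head[of e] by simp
    qed
    then have "{#e \<in># V. head (attach N v G) e = Some u#}
        = {#e \<in># V. if u = v then e \<in> inputs G else head N e = Some u#}"
      by (intro filter_mset_cong refl)
    then show ?thesis by simp
  qed
  have head_E: "{#e \<in># ?E. head (attach N v G) e = Some u#} = {#}" for u
    using E by (auto simp: attach_def)
  have tail_V: "{#e \<in># V. tail (attach N v G) e = t#} = {#e \<in># V. tail N e = t#}" for t
    using edges K by (intro filter_mset_cong) (auto simp: attach_def)
  have tail_E: "{#e \<in># ?E. tail (attach N v G) e = t#} = (if t = Some v then ?E else {#})" for t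
  proof -
    have "{#e \<in># ?E. tail (attach N v G) e = t#} = {#e \<in># ?E. t = Some v#}"
      by (intro filter_mset_cong refl) (auto simp: attach_def dest!: subsetD[OF E])
    then show ?thesis by simp
  qed
  have tail_v: "{#e \<in># V. tail N e = Some v#} = {#}"
    using edges attach_not_into_v(2) by auto
  show ?thesis
    unfolding flow_def V'_def filter_union_mset head_V head_E tail_V tail_E
  proof (intro conjI ballI)
    show "set_mset (V + ?E) \<subseteq> edges (attach N v G)"
      using edges E by (auto simp: attach_def)
    show "{#e \<in># V. tail N e = None#} + (if None = Some v then ?E else {#}) = x"
      using V by (simp add: flow_def)
    fix u assume "u \<in> nodes (attach N v G)"
    then consider "u = v" | "u \<in> nodes N" "u \<noteq> v" using v by (auto simp: attach_def)
    then show "{#e \<in># V. tail N e = Some u#} + (if Some u = Some v then ?E else {#})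
        = computed_fun (proc (attach N v G) u)
          ((if u = v then {#e \<in># V. e \<in> inputs G#} else {#e \<in># V. head N e = Some u#}) + {#})"
    proof cases
      case 1
      then show ?thesis using tail_v by (simp add: attach_def)
    next
      case 2
      then show ?thesis using V by (simp add: attach_def flow_def)
    qed
  qed
qed

end

lemma attach_circuit:
  assumes "circuit N" "finite_abelian_processor G" "is_gate G" "\<And>u. u \<in> nodes N \<Longrightarrow> u < v"
    "inputs G \<subseteq> output_edges N" "outputs G \<inter> edges N = {}"
  shows "circuit (attach N v G)"
proof -
  interpret abelian_network N using assms(1) by (simp add: circuit_def)
  have "v \<notin> nodes N" using assms(4) by blast
  then have "abelian_network (attach N v G)"
    using assms by (intro attach_abelian_network) (auto simp: circuit_def)
  moreover have "is_gate (proc (attach N v G) u)" if "u \<in> nodes (attach N v G)" for u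
    using that assms(1,3) by (auto simp: attach_def circuit_def)
  moreover have "u < u'" if "e \<in> edges (attach N v G)" "tail (attach N v G) e = Some u"
      "head (attach N v G) e = Some u'" for e u u'
    using that assms(1,4) tail_in_nodes
    by (auto simp: attach_def circuit_def split: if_splits)
  ultimately show ?thesis unfolding circuit_def by blast
qed

section \<open>The stock of functions on the output edges\<close>

section \<open>Realizable families of functions\<close>

text \<open>
  The multiset \<open>M\<close> lists the functions computed on the output edges. Letters of \<open>x\<close> outside \<open>A\<close> are
  ignored, which makes the edge loads \<open>V x\<close> meaningful for every \<open>x\<close>, so that equality of the
  functions in \<open>M\<close> is plain equality.
\<close>

definition realizable :: "'a set \<Rightarrow> ('a multiset \<Rightarrow> nat) multiset \<Rightarrow> bool" where
  "realizable A M \<longleftrightarrow>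
     (\<exists>N \<alpha> V. circuit N \<and> bij_betw \<alpha> A (input_edges N) \<and>
        (\<forall>x. flow N (image_mset \<alpha> {#a \<in># x. a \<in> A#}) (V x)) \<and>
        M = image_mset (\<lambda>e x. count (V x) e) (mset_set (output_edges N)))"

text \<open>The edges are distinct although the functions on them may coincide. Once a splitting of
  the functions is lifted to the edges, its parts are therefore sets of edges.\<close>

lemma mset_set_eq_plusD:
  assumes "finite A" "mset_set A = B + C"
  obtains I where "I \<subseteq> A" "B = mset_set I" "C = mset_set (A - I)"
proof -
  have count: "count B a + count C a = (if a \<in> A then 1 else 0)" for a
    using arg_cong[OF assms(2), of "\<lambda>M. count M a"] assms(1) by (simp add: count_mset_set')
  have B: "count B a = (if a \<in># B then 1 else 0)" for a
  proof (cases "a \<in># B")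
    case True
    then have "count B a \<noteq> 0" by simp
    moreover have "count B a \<le> 1" using count[of a] by (simp split: if_splits)
    ultimately have "count B a = 1" by linarith
    then show ?thesis using True by simp
  qed (simp add: not_in_iff)
  have sub: "set_mset B \<subseteq> A"
  proof
    fix a assume "a \<in># B"
    then show "a \<in> A" using B[of a] count[of a] by (simp split: if_splits)
  qed
  show ?thesis
  proof (rule that[OF sub])
    show "B = mset_set (set_mset B)"
      by (rule multiset_eqI) (subst B, simp add: count_mset_set')
    show "C = mset_set (A - set_mset B)"
    proof (rule multiset_eqI)
      fix a
      show "count C a = count (mset_set (A - set_mset B)) a"
        using count[of a] B[of a] sub assms(1) by (auto simp: count_mset_set' split: if_splits)
    qed
  qed
qed

lemma count_image_mset_inj_on:
  assumes "inj_on f A" "set_mset X \<subseteq> A" "a \<in> A"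
  shows "count (image_mset f X) (f a) = count X a"
proof -
  have "f a = f b \<longleftrightarrow> b = a" if "b \<in># X" for b
    using inj_on_eq_iff[OF assms(1)] assms(2,3) that by blast
  then have "{b. b \<in># X \<and> f a = f b} = {b. b \<in># X \<and> b = a}" by blast
  also have "\<dots> = (if a \<in># X then {a} else {})" by auto
  finally show ?thesis unfolding count_image_mset' by (simp add: not_in_iff)
qed

lemma size_filter_mset_eq_sum:
  assumes "finite I"
  shows "size {#e \<in># V. e \<in> I#} = (\<Sum>e\<in>I. count V e)"
proof (induction V)
  case (add x V)
  have "(\<Sum>e\<in>I. count (add_mset x V) e) = (\<Sum>e\<in>I. (if e = x then 1 else 0) + count V e)"
    by (intro sum.cong) auto
  then show ?case using add assms by (simp add: sum.distrib)
qed simp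

text \<open>Since the gate depends only on the total load, feeding it the edges that carry
  \<open>F\<close> makes it see the sum of \<open>F\<close>. These edges cease to be output edges,
  so \<open>F\<close> is used up.\<close>

lemma realizable_attach:
  assumes "realizable A (F + M)" "gate_computes (size F) q h" "q > 0"
  shows "realizable A (replicate_mset q (\<lambda>x. h (\<Sum>f\<in>#F. f x)) + M)"
proof -
  obtain N \<alpha> V where N: "circuit N" and \<alpha>: "bij_betw \<alpha> A (input_edges N)"
    and flow: "\<And>x. flow N (image_mset \<alpha> {#a \<in># x. a \<in> A#}) (V x)"
    and M: "F + M = image_mset (\<lambda>e x. count (V x) e) (mset_set (output_edges N))"
    using assms(1) unfolding realizable_def by blast
  interpret abelian_network N using N by (simp add: circuit_def)
  let ?g = "\<lambda>e x. count (V x) e"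
  let ?O = "output_edges N"
  have fin: "finite ?O" using dangling_edges finite_edges by (meson finite_subset)
  obtain B C where BC: "mset_set ?O = B + C" "F = image_mset ?g B" "M = image_mset ?g C"
    using image_mset_eq_plusD[OF M[symmetric]] by blast
  obtain I where I: "I \<subseteq> ?O" "B = mset_set I" "C = mset_set (?O - I)"
    using mset_set_eq_plusD[OF fin BC(1)] by blast
  have finI: "finite I" using I(1) fin by (rule finite_subset)
  \<comment> \<open>Edge names from \<open>m\<close> on are fresh, and a node \<open>v\<close> above
    all others continues the topological numbering.\<close>
  obtain m where m: "\<And>e. e \<in> edges N \<Longrightarrow> e < m"
    using finite_nat_set_iff_bounded[of "edges N"] finite_edges by blast
  obtain v where v: "\<And>u. u \<in> nodes N \<Longrightarrow> u < v"
    using finite_nat_set_iff_bounded[of "nodes N"] finite_nodes by blast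
  define K where "K = {m..<m + q}"
  have K: "card K = q" "finite K" "K \<inter> edges N = {}" using m by (fastforce simp: K_def)+
  have "card I = size F" using BC(2) I(2) by simp
  then obtain G where G: "finite_abelian_processor G" "is_gate G" "inputs G = I" "outputs G = K"
    and count_G: "\<And>y k. set_mset y \<subseteq> I \<Longrightarrow> k \<in> K \<Longrightarrow> count (computed_fun G y) k = h (size y)"
    using assms(2) K(1) unfolding gate_computes_def by metis
  interpret G: finite_abelian_processor G by fact
  let ?V = "\<lambda>x. V x + computed_fun G {#e \<in># V x. e \<in> I#}"
  let ?N = "attach N v G"
  have V_edges: "set_mset (V x) \<subseteq> edges N" for x using flow[of x] by (simp add: flow_def)
  have "circuit ?N"
    using N G v I(1) K(3) by (intro attach_circuit) auto
  moreover have "bij_betw \<alpha> A (input_edges ?N)" using \<alpha> by (simp add: attach_def)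
  moreover have "flow ?N (image_mset \<alpha> {#a \<in># x. a \<in> A#}) (?V x)" for x
    using attach_flow[OF _ G(1) _ _ _ flow, of v x] N v G(3,4) I(1) K(3)
    by (auto simp: circuit_def)
  moreover have "replicate_mset q (\<lambda>x. h (\<Sum>f\<in>#F. f x)) + M
      = image_mset (\<lambda>e x. count (?V x) e) (mset_set (output_edges ?N))"
  proof -
    have old: "(\<lambda>x. count (?V x) e) = (\<lambda>x. count (V x) e)" if "e \<in> ?O - I" for e
    proof -
      have "e \<notin> K" using that K(3) dangling_edges by blast
      then have "count (computed_fun G {#e \<in># V x. e \<in> I#}) e = 0" for x
        using G.computed_fun_in_outputs[of "{#e \<in># V x. e \<in> I#}"] G(3,4)
        by (auto intro!: count_inI)
      then show ?thesis by simp
    qed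
    have new: "(\<lambda>x. count (?V x) k) = (\<lambda>x. h (\<Sum>f\<in>#F. f x))" if "k \<in> K" for k
    proof
      fix x
      have "k \<notin># V x" using that K(3) V_edges[of x] by blast
      moreover have "size {#e \<in># V x. e \<in> I#} = (\<Sum>f\<in>#F. f x)"
        unfolding BC(2) I(2) size_filter_mset_eq_sum[OF finI]
        by (simp add: image_mset.compositionality comp_def sum_unfold_sum_mset)
      ultimately show "count (?V x) k = h (\<Sum>f\<in>#F. f x)"
        using count_G[OF _ that, of "{#e \<in># V x. e \<in> I#}"] by (auto simp: not_in_iff)
    qed
    have "mset_set (output_edges ?N) = mset_set K + mset_set (?O - I)"
      using K dangling_edges fin G(3,4)
      by (subst mset_set_Union[symmetric]) (auto simp: attach_def intro: arg_cong[of _ _ mset_set])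
    moreover have "image_mset (\<lambda>e x. count (?V x) e) (mset_set K)
        = image_mset (\<lambda>_ x. h (\<Sum>f\<in>#F. f x)) (mset_set K)"
      using new K(2) by (intro image_mset_cong) auto
    moreover have "image_mset (\<lambda>e x. count (?V x) e) (mset_set (?O - I)) = M"
      unfolding BC(3) I(3) using old fin by (intro image_mset_cong) auto
    ultimately show ?thesis using K(1) by (simp add: image_mset_const_eq)
  qed
  ultimately show ?thesis
    unfolding realizable_def
    by (intro exI[of _ ?N] exI[of _ \<alpha>] exI[of _ ?V] conjI allI)
qed

text \<open>Unwanted output edges become trash. The flow equations do not distinguish the two kinds,
  so the same loads solve them.\<close>

lemma realizable_drop:
  assumes "realizable A (F + M)"
  shows "realizable A M"
proof -
  obtain N \<alpha> V where N: "circuit N" and \<alpha>: "bij_betw \<alpha> A (input_edges N)"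
    and flow: "\<And>x. flow N (image_mset \<alpha> {#a \<in># x. a \<in> A#}) (V x)"
    and M: "F + M = image_mset (\<lambda>e x. count (V x) e) (mset_set (output_edges N))"
    using assms unfolding realizable_def by blast
  interpret abelian_network N using N by (simp add: circuit_def)
  have fin: "finite (output_edges N)" using dangling_edges finite_edges by (meson finite_subset)
  obtain B C where BC: "mset_set (output_edges N) = B + C"
      "M = image_mset (\<lambda>e x. count (V x) e) C"
    using image_mset_eq_plusD[OF M[symmetric]] by blast
  obtain I where I: "I \<subseteq> output_edges N" "C = mset_set (output_edges N - I)"
    by (rule mset_set_eq_plusD[OF fin BC(1)])
  define N' where "N' = N\<lparr>output_edges := output_edges N - I, trash_edges := trash_edges N \<union> I\<rparr>"
  have sel: "nodes N' = nodes N" "edges N' = edges N" "input_edges N' = input_edges N"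
    "tail N' = tail N" "head N' = head N" "proc N' = proc N"
    "output_edges N' = output_edges N - I" "trash_edges N' = trash_edges N \<union> I"
    by (simp_all add: N'_def)
  have inc: "incoming N' = incoming N" "outgoing N' = outgoing N"
    by (simp_all add: incoming_def outgoing_def sel fun_eq_iff)
  have "abelian_network N'"
  proof (rule abelian_network.intro; unfold sel inc)
    show "output_edges N - I \<subseteq> edges N" "trash_edges N \<union> I \<subseteq> edges N"
      using dangling_edges I(1) by blast+
    show "input_edges N \<inter> (output_edges N - I) = {}" "input_edges N \<inter> (trash_edges N \<union> I) = {}"
      "(output_edges N - I) \<inter> (trash_edges N \<union> I) = {}"
      using disjoint_edges I(1) by blast+
    show "head N e = None \<longleftrightarrow> e \<in> output_edges N - I \<union> (trash_edges N \<union> I)" if "e \<in> edges N" for e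
      using head_None_iff[OF that] I(1) by blast
  qed (rule finite_nodes finite_edges dangling_edges tail_None_iff tail_in_nodes head_in_nodes
      proc_abelian proc_inputs proc_outputs; assumption)+
  then have "circuit N'" using N unfolding circuit_def sel by blast
  moreover have "flow N' (image_mset \<alpha> {#a \<in># x. a \<in> A#}) (V x)" for x
    using flow[of x] unfolding flow_def sel .
  ultimately show ?thesis
    using \<alpha> BC(2) unfolding realizable_def I(2)
    by (intro exI[of _ N'] exI[of _ \<alpha>] exI[of _ V]) (simp add: sel)
qed

definition input_counts :: "'a set \<Rightarrow> ('a multiset \<Rightarrow> nat) multiset" where
  "input_counts A = image_mset (\<lambda>a x. count x a) (mset_set A)"

text \<open>A delayer in state 1 is the identity gate; it separates the input edges from the output
  edges.\<close>

lemma realizable_input_counts: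
  assumes "finite A"
  shows "realizable A (input_counts A)"
proof -
  obtain \<alpha> :: "'a \<Rightarrow> nat" and n where \<alpha>: "bij_betw \<alpha> A {..<n}"
    using ex_bij_betw_finite_nat[OF assms] by (auto simp: lessThan_atLeast0)
  \<comment> \<open>For each \<open>v < n\<close>, edge \<open>v\<close> enters node
    \<open>v\<close> and edge \<open>n + v\<close> leaves it; input letter \<open>a\<close> uses
    node \<open>\<alpha> a\<close>.\<close>
  define N :: "(nat, nat, nat) network" where
    "N = \<lparr>nodes = {..<n}, edges = {..<2 * n}, input_edges = {..<n}, output_edges = {n..<2 * n},
       trash_edges = {}, tail = (\<lambda>e. if e < n then None else Some (e - n)),
       head = (\<lambda>e. if e < n then Some e else None), proc = (\<lambda>v. delayer 1 v (n + v))\<rparr>"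
  have sel: "nodes N = {..<n}" "edges N = {..<2 * n}" "input_edges N = {..<n}"
    "output_edges N = {n..<2 * n}" "trash_edges N = {}"
    "tail N = (\<lambda>e. if e < n then None else Some (e - n))"
    "head N = (\<lambda>e. if e < n then Some e else None)" "proc N = (\<lambda>v. delayer 1 v (n + v))"
    by (simp_all add: N_def)
  define V where "V x = image_mset \<alpha> {#a \<in># x. a \<in> A#}
      + image_mset (\<lambda>a. n + \<alpha> a) {#a \<in># x. a \<in> A#}" for x
  have "abelian_network N"
    by (rule abelian_network.intro)
      (auto simp: sel incoming_def outgoing_def delayer_abelian split: if_splits)
  then have circuit: "circuit N"
    by (auto simp: circuit_def sel is_gate_delayer)
  have \<alpha>_less: "\<alpha> a < n" if "a \<in> A" for a using \<alpha> that by (auto simp: bij_betw_def)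
  have count_V: "count (V x) (n + \<alpha> a) = count x a" if "a \<in> A" for a x
  proof -
    have "n + \<alpha> a \<notin># image_mset \<alpha> {#a \<in># x. a \<in> A#}" using \<alpha>_less by fastforce
    then have "count (image_mset \<alpha> {#a \<in># x. a \<in> A#}) (n + \<alpha> a) = 0"
      by (simp only: not_in_iff)
    moreover have "inj_on (\<lambda>a. n + \<alpha> a) A" using \<alpha> by (auto simp: bij_betw_def inj_on_def)
    ultimately show ?thesis
      unfolding V_def
      using count_image_mset_inj_on[of "\<lambda>a. n + \<alpha> a" A "{#a \<in># x. a \<in> A#}" a] that
      by (simp add: subset_iff)
  qed
  have "bij_betw \<alpha> A (input_edges N)" using \<alpha> by (simp add: sel)
  moreover note circuit
  moreover have "flow N (image_mset \<alpha> {#a \<in># x. a \<in> A#}) (V x)" for x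
    unfolding flow_def
  proof (intro conjI ballI)
    show "set_mset (V x) \<subseteq> edges N" using \<alpha>_less by (fastforce simp: V_def sel)
    show "{#e \<in># V x. tail N e = None#} = image_mset \<alpha> {#a \<in># x. a \<in> A#}"
      unfolding V_def by (induction x) (auto simp: sel \<alpha>_less)
    fix v assume "v \<in> nodes N"
    interpret finite_abelian_processor "delayer 1 v (n + v)" by (rule delayer_abelian) simp
    have into: "{#e \<in># V x. head N e = Some v#} = replicate_mset (count (image_mset \<alpha> {#a \<in># x. a \<in> A#}) v) v"
      unfolding V_def by (induction x) (auto simp: sel \<alpha>_less)
    have "{#e \<in># V x. tail N e = Some v#}
        = replicate_mset (count (image_mset \<alpha> {#a \<in># x. a \<in> A#}) v) (n + v)"
      unfolding V_def by (induction x) (auto simp: sel \<alpha>_less)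
    also have "\<dots> = computed_fun (proc N v) {#e \<in># V x. head N e = Some v#}"
      using total_output_eq_computed_fun[of "replicate (count (image_mset \<alpha> {#a \<in># x. a \<in> A#}) v) v"]
        total_output_delayer_1[of 1 v "n + v"]
      unfolding into by (simp add: sel set_replicate_conv_if)
    finally show "{#e \<in># V x. tail N e = Some v#}
        = computed_fun (proc N v) {#e \<in># V x. head N e = Some v#}" .
  qed
  moreover have "input_counts A = image_mset (\<lambda>e x. count (V x) e) (mset_set (output_edges N))"
  proof -
    have "bij_betw (\<lambda>a. n + \<alpha> a) A {n..<2 * n}"
    proof (rule bij_betw_imageI)
      show "inj_on (\<lambda>a. n + \<alpha> a) A" using \<alpha> by (auto simp: bij_betw_def inj_on_def)
      have "(\<lambda>a. n + \<alpha> a) ` A = (\<lambda>i. n + i) ` (\<alpha> ` A)" by (simp add: image_image)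
      also have "\<dots> = {n..<2 * n}" using \<alpha> by (simp add: bij_betw_def lessThan_atLeast0 mult_2)
      finally show "(\<lambda>a. n + \<alpha> a) ` A = {n..<2 * n}" .
    qed
    then have "mset_set (output_edges N) = image_mset (\<lambda>a. n + \<alpha> a) (mset_set A)"
      by (simp add: sel bij_betw_def image_mset_mset_set)
    then show ?thesis
      using count_V assms
      by (auto simp: input_counts_def image_mset.compositionality comp_def intro!: image_mset_cong)
  qed
  ultimately show ?thesis
    unfolding realizable_def
    by (intro exI[of _ N] exI[of _ \<alpha>] exI[of _ V] conjI allI)
qed

text \<open>A gate uses up its incoming edges, so \<open>input_counts A\<close> is kept as a
  reserve: the case \<open>input\<close> splits one of its edges, takes one copy and puts the other
  back. \<open>M\<close> is arbitrary because in a sum the second term already waits in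
  \<open>M\<close> while the first is built.\<close>

lemma realizable_gate_term:
  assumes "finite A" "gate_term A f" "realizable A (M + input_counts A)"
  shows "realizable A (add_mset f M + input_counts A)"
  using assms(2,3)
proof (induction arbitrary: M)
  case (input a)
  define R where "R = input_counts (A - {a})"
  have I: "input_counts A = add_mset (\<lambda>x. count x a) R"
    using assms(1) input.hyps by (simp add: input_counts_def R_def mset_set.remove)
  have "realizable A ({#\<lambda>x. count x a#} + (M + R))" using input.prems by (simp add: I)
  from realizable_attach[OF this, of 2 "\<lambda>n. n"] gate_computes_split
  show ?case by (simp add: I numeral_2_eq_2)
next
  case (add f g)
  have "realizable A ({#f, g#} + (M + input_counts A))"
    using add.IH(1)[OF add.IH(2)[OF add.prems]] by simp
  from realizable_attach[OF this, of 1 "\<lambda>n. n"] gate_computes_add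
  show ?case by (simp add: numeral_2_eq_2)
next
  case (delay f)
  have "realizable A ({#f#} + (M + input_counts A))" using delay.IH[OF delay.prems] by simp
  from realizable_attach[OF this, of 1 "\<lambda>n. n - 1"] gate_computes_delay
  show ?case by simp
next
  case (presink f)
  have "realizable A ({#f#} + (M + input_counts A))" using presink.IH[OF presink.prems] by simp
  from realizable_attach[OF this, of 1 "\<lambda>n. min 1 n"] gate_computes_presink
  show ?case by simp
next
  case (zero f)
  have "realizable A ({#f#} + (M + input_counts A))" using zero.IH[OF zero.prems] by simp
  from realizable_attach[OF this, of 1 "\<lambda>_. 0"] gate_computes_zero
  show ?case by simp
qed

lemma realizable_gate_terms:
  assumes "finite A" "\<And>f. f \<in># M \<Longrightarrow> gate_term A f"
  shows "realizable A M"
proof -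
  have "realizable A (M + input_counts A)"
    using assms(2)
  proof (induction M)
    case empty
    show ?case using realizable_input_counts[OF assms(1)] by simp
  next
    case (add f M)
    then show ?case using realizable_gate_term[OF assms(1)] by simp
  qed
  then show ?thesis
    using realizable_drop[of A "input_counts A" M] by (simp add: add.commute)
qed

text \<open>The multiset of functions forgets which output letter belongs to which edge. Any
  matching of equal functions serves, and it is built one letter at a time.\<close>

lemma image_mset_set_eq_bij_betw:
  assumes "finite A" "finite B" "image_mset f (mset_set A) = image_mset g (mset_set B)"
  shows "\<exists>\<beta>. bij_betw \<beta> A B \<and> (\<forall>a\<in>A. g (\<beta> a) = f a)"
  using assms
proof (induction A arbitrary: B rule: finite_induct)
  case empty
  then have "B = {}" by (simp add: mset_set_empty_iff)
  then show ?case by (simp add: bij_betw_def)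
next
  case (insert a A)
  then have "f a \<in># image_mset g (mset_set B)"
    by (metis image_mset_add_mset mset_set.insert union_single_eq_member)
  then obtain b where b: "b \<in> B" "g b = f a" using insert.prems(1) by auto
  have "image_mset f (mset_set A) = image_mset g (mset_set (B - {b}))"
    using insert.prems insert.hyps b by (simp add: mset_set.remove[of B b])
  then obtain \<beta> where \<beta>: "bij_betw \<beta> A (B - {b})" "\<forall>a\<in>A. g (\<beta> a) = f a"
    using insert.IH[of "B - {b}"] insert.prems(1) by auto
  have "bij_betw (\<beta>(a := b)) A (B - {b})"
    using \<beta>(1) insert.hyps(2) by (subst bij_betw_cong[of A _ \<beta>]) auto
  then have "bij_betw (\<beta>(a := b)) (A \<union> {a}) ((B - {b}) \<union> {b})"
    using insert.hyps(2) notIn_Un_bij_betw[of a A "\<beta>(a := b)" "B - {b}"] by simp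
  then have "bij_betw (\<beta>(a := b)) (insert a A) B" using b(1) by (simp add: insert_absorb)
  moreover have "\<forall>c\<in>insert a A. g ((\<beta>(a := b)) c) = f c" using \<beta>(2) b(2) by auto
  ultimately show ?case by blast
qed

text \<open>The last hypothesis excludes a processor with outputs but no inputs. Every gate has an
  incoming edge, so going backwards from an output edge of a finite acyclic network of gates must
  end at an input edge.\<close>

theorem theorem1p2:
  fixes P :: "('a, 'b, 'q) processor"
  assumes "finite_abelian_processor P"
    and "all_states_reachable P"
    and "bounded_processor P"
    and "outputs P \<noteq> {} \<Longrightarrow> inputs P \<noteq> {}"
  shows "\<exists>N :: (nat, nat, nat) network.
           abelian_network N \<and> directed_acyclic N \<and>
           (\<forall>v \<in> nodes N. is_adder (proc N v) \<or> is_splitter (proc N v) \<or>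
              is_delayer (proc N v) \<or> is_presink (proc N v)) \<and>
           emulates N P"
proof -
  interpret bounded_finite_abelian_processor P
    using assms(1-3)
    by (simp add: bounded_finite_abelian_processor_def bounded_finite_abelian_processor_axioms_def)
  let ?F = "computed_fun P"
  define f where "f b = (SOME f. gate_term (inputs P) f \<and>
      (\<forall>x. set_mset x \<subseteq> inputs P \<longrightarrow> f x = count (?F x) b))" for b
  have "gate_term (inputs P) (f b) \<and>
      (\<forall>x. set_mset x \<subseteq> inputs P \<longrightarrow> f b x = count (?F x) b)" if "b \<in> outputs P" for b
    unfolding f_def
    by (rule someI_ex[OF output_gate_term]) (use that assms(4) in blast)
  then have f: "gate_term (inputs P) (f b)"
      "set_mset x \<subseteq> inputs P \<Longrightarrow> f b x = count (?F x) b" if "b \<in> outputs P" for b x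
    using that by blast+
  have "realizable (inputs P) (image_mset f (mset_set (outputs P)))"
    by (rule realizable_gate_terms[OF finite_inputs]) (auto simp: finite_outputs f(1))
  then obtain N \<alpha> V where N: "circuit N" and \<alpha>: "bij_betw \<alpha> (inputs P) (input_edges N)"
    and flow: "\<And>x. flow N (image_mset \<alpha> {#a \<in># x. a \<in> inputs P#}) (V x)"
    and M: "image_mset f (mset_set (outputs P))
      = image_mset (\<lambda>e x. count (V x) e) (mset_set (output_edges N))"
    unfolding realizable_def by blast
  interpret N: abelian_network N using N by (simp add: circuit_def)
  have "finite (output_edges N)" using N.dangling_edges N.finite_edges by (meson finite_subset)
  from image_mset_set_eq_bij_betw[OF finite_outputs this M]
  obtain \<beta> where \<beta>: "bij_betw \<beta> (outputs P) (output_edges N)"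
      "\<And>b x. b \<in> outputs P \<Longrightarrow> count (V x) (\<beta> b) = f b x"
    by (auto simp: fun_eq_iff)
  have "halts_with_output N (image_mset \<alpha> x) (image_mset \<beta> (?F x))"
    if x: "set_mset x \<subseteq> inputs P" for x
  proof -
    have "{#a \<in># x. a \<in> inputs P#} = x" using x by (auto simp: filter_mset_eq_conv)
    then have "flow N (image_mset \<alpha> x) (V x)" using flow[of x] by simp
    moreover have "set_mset (image_mset \<alpha> x) \<subseteq> input_edges N"
      using x \<alpha> by (auto simp: bij_betw_def)
    ultimately have "halts_with_output N (image_mset \<alpha> x) {#e \<in># V x. e \<in> output_edges N#}"
      using N.halts_with_output_flow circuit_directed_acyclic[OF N] by blast
    moreover have "{#e \<in># V x. e \<in> output_edges N#} = image_mset \<beta> (?F x)"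
    proof (rule multiset_eqI)
      fix e
      have F: "set_mset (?F x) \<subseteq> outputs P" using x by (rule computed_fun_in_outputs)
      show "count {#e \<in># V x. e \<in> output_edges N#} e = count (image_mset \<beta> (?F x)) e"
      proof (cases "e \<in> output_edges N")
        case True
        then obtain b where b: "b \<in> outputs P" "e = \<beta> b" using \<beta>(1) by (auto simp: bij_betw_def)
        have "count (image_mset \<beta> (?F x)) (\<beta> b) = count (?F x) b"
          by (rule count_image_mset_inj_on[OF bij_betw_imp_inj_on[OF \<beta>(1)] F b(1)])
        then show ?thesis using True b \<beta>(2) f(2)[OF b(1) x] by simp
      next
        case False
        then have "e \<notin># image_mset \<beta> (?F x)" using F \<beta>(1) by (auto simp: bij_betw_def)
        then show ?thesis using False unfolding not_in_iff by simp
      qed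
    qed
    ultimately show ?thesis by simp
  qed
  then have "emulates N P" unfolding emulates_def using \<alpha> \<beta>(1) by blast
  then show ?thesis
    using N N.abelian_network_axioms circuit_directed_acyclic[OF N]
    unfolding circuit_def is_gate_def by blast
qed

end
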